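(* Let $(X,d)$ be a metric space, let $f$ be a compatible unbounded modulus function, let $(A_k)_{k\ge 1}\subset CL(X)$ and $A\in CL(X)$. The following conditions are equivalent: (a) $(A_k)_k$ is Wijsman $f$-statistically convergent to $A$. (b) $(A_k)_k$ is Wijsman statistically convergent to $A$.
   Context: $\mathbb{R}^+=[0,\infty)$. A modulus function is a function $f:\mathbb{R}^+\to\mathbb{R}^+$ such that: $f(x)=0$ if and only if $x=0$; $f(x+y)\le f(x)+f(y)$ for all $x,y\in\mathbb{R}^+$; $f$ is increasing ($x\le y$ implies $f(x)\le f(y)$); $f$ is continuous from the right at $0$. All modulus functions are assumed unbounded. $f$ is compatible if $\lim_{\varepsilon\to 0^+}\varphi(\varepsilon)=0$, where $\varphi(\varepsilon)=\limsup_{n\to\infty}\frac{f(n\varepsilon)}{f(n)}$ ($n\in\mathbb{N}$). $CL(X)$ is the family of all nonempty closed subsets of $X$, and $d(x,A)=\inf_{a\in A}d(x,a)$. $\#$ denotes cardinality. A real sequence $(x_k)_{k\ge1}$ is $f$-statistically convergent to $L$ if for every $\varepsilon>0$, $\lim_{n\to\infty}\frac{1}{f(n)}f(\#\{k\le n: |x_k-L|>\varepsilon\})=0$; it is statistically convergent to $L$ if for every $\varepsilon>0$, $\lim_{n\to\infty}\frac1n\#\{k\le n:|x_k-L|>\varepsilon\}=0$. $(A_k)_k\subset CL(X)$ is Wijsman $f$-statistically convergent (resp. Wijsman statistically convergent) to $A\in CL(X)$ if for every $x\in X$ the real sequence $(d(x,A_k))_k$ is $f$-statistically convergent (resp. statistically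 convergent) to $d(x,A)$. *)

theory Defs
  imports "HOL-Analysis.Analysis"
begin

text \<open>
  A function from \<open>[0, \<infinity>)\<close> to itself is represented by a total function on the reals; only its
  values on \<open>[0, \<infinity>)\<close> are constrained or used.
\<close>

definition modulus_function :: "(real \<Rightarrow> real) \<Rightarrow> bool" where
  "modulus_function f \<longleftrightarrow>
     (\<forall>x\<ge>0. f x \<ge> 0) \<and>
     (\<forall>x\<ge>0. f x = 0 \<longleftrightarrow> x = 0) \<and>
     (\<forall>x\<ge>0. \<forall>y\<ge>0. f (x + y) \<le> f x + f y) \<and>
     mono_on {0..} f \<and>
     continuous (at_right 0) f"

definition unbounded_modulus_function :: "(real \<Rightarrow> real) \<Rightarrow> bool" where
  "unbounded_modulus_function f \<longleftrightarrow> modulus_function f \<and> \<not> bounded (f ` {0..})"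

text \<open>The upper limit is taken in the extended reals, where it always exists.\<close>

definition modulus_limsup :: "(real \<Rightarrow> real) \<Rightarrow> real \<Rightarrow> ereal" where
  "modulus_limsup f \<epsilon> = limsup (\<lambda>n::nat. ereal (f (real n * \<epsilon>) / f (real n)))"

definition compatible_modulus :: "(real \<Rightarrow> real) \<Rightarrow> bool" where
  "compatible_modulus f \<longleftrightarrow> (modulus_limsup f \<longlongrightarrow> 0) (at_right 0)"

definition CL :: "'a::metric_space set set" where
  "CL = {A. closed A \<and> A \<noteq> {}}"

text \<open>
  Sequences are indexed by \<open>k \<ge> 1\<close>; the value at index \<open>0\<close> is ignored. For nonempty \<open>A\<close>,
  \<^term>\<open>infdist x A\<close> is the infimum of the distances from \<open>x\<close> to the points of \<open>A\<close>.
\<close>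

definition f_statistically_convergent ::
    "(real \<Rightarrow> real) \<Rightarrow> (nat \<Rightarrow> real) \<Rightarrow> real \<Rightarrow> bool" where
  "f_statistically_convergent f x L \<longleftrightarrow>
     (\<forall>\<epsilon>>0. (\<lambda>n. f (real (card {k\<in>{1..n}. \<bar>x k - L\<bar> > \<epsilon>})) / f (real n)) \<longlonglongrightarrow> 0)"

definition statistically_convergent :: "(nat \<Rightarrow> real) \<Rightarrow> real \<Rightarrow> bool" where
  "statistically_convergent x L \<longleftrightarrow>
     (\<forall>\<epsilon>>0. (\<lambda>n. real (card {k\<in>{1..n}. \<bar>x k - L\<bar> > \<epsilon>}) / real n) \<longlonglongrightarrow> 0)"

definition Wijsman_f_statistically_convergent ::
    "(real \<Rightarrow> real) \<Rightarrow> (nat \<Rightarrow> 'a::metric_space set) \<Rightarrow> 'a set \<Rightarrow> bool" where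
  "Wijsman_f_statistically_convergent f A B \<longleftrightarrow>
     (\<forall>x. f_statistically_convergent f (\<lambda>k. infdist x (A k)) (infdist x B))"

definition Wijsman_statistically_convergent ::
    "(nat \<Rightarrow> 'a::metric_space set) \<Rightarrow> 'a set \<Rightarrow> bool" where
  "Wijsman_statistically_convergent A B \<longleftrightarrow>
     (\<forall>x. statistically_convergent (\<lambda>k. infdist x (A k)) (infdist x B))"

end

theory Submission
  imports Defs
begin

text \<open>
  Both notions of convergence compare a counting function \<open>c n\<close> with \<open>n\<close>. Subadditivity gives
  \<open>f n \<le> f (m * c n) \<le> m * f (c n)\<close> whenever \<open>n \<le> m * c n\<close>, so \<open>f (c n) / f n < 1 / m\<close> forces
  \<open>c n / n < 1 / m\<close>; this direction holds for every modulus. Conversely \<open>c n \<le> n * \<epsilon>\<close> gives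
  \<open>f (c n) / f n \<le> f (n * \<epsilon>) / f n\<close>, which compatibility makes eventually small.
\<close>

lemma modulus_function_mono:
  assumes "modulus_function f" "0 \<le> x" "x \<le> y"
  shows "f x \<le> f y"
  using assms unfolding modulus_function_def by (auto dest!: mono_onD[where r = x and s = y])

lemma modulus_function_nonneg:
  assumes "modulus_function f" "0 \<le> x"
  shows "0 \<le> f x"
  using assms unfolding modulus_function_def by blast

lemma modulus_function_pos:
  assumes "modulus_function f" "0 < x"
  shows "0 < f x"
  using assms unfolding modulus_function_def by (metis less_eq_real_def order_less_irrefl)

text \<open>Subadditivity iterated, starting from \<open>f 0 = 0\<close>. It bounds \<open>f\<close>
  at an integer multiple of a point, so thresholds are later taken of the form
  \<open>1 / m\<close>.\<close>

lemma modulus_function_mult_of_nat_le: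
  assumes "modulus_function f" "0 \<le> x"
  shows "f (real m * x) \<le> real m * f x"
proof (induction m)
  case 0
  have "f 0 = 0" using assms unfolding modulus_function_def by blast
  then show ?case by simp
next
  case (Suc m)
  have "f (real (Suc m) * x) = f (real m * x + x)"
    by (simp add: algebra_simps)
  also have "\<dots> \<le> f (real m * x) + f x"
    using assms unfolding modulus_function_def by simp
  also have "\<dots> \<le> real (Suc m) * f x"
    using Suc by (simp add: algebra_simps)
  finally show ?case .
qed

lemma ratio_tendsto_0_if_modulus_ratio_tendsto_0:
  fixes c :: "nat \<Rightarrow> real"
  assumes f: "modulus_function f" and c: "\<And>n. 0 \<le> c n"
    and lim: "(\<lambda>n. f (c n) / f (real n)) \<longlonglongrightarrow> 0"
  shows "(\<lambda>n. c n / real n) \<longlonglongrightarrow> 0"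
proof (rule order_tendstoI)
  fix a :: real assume "a < 0"
  moreover have "0 \<le> c n / real n" for n
    using c by simp
  ultimately show "\<forall>\<^sub>F n in sequentially. a < c n / real n"
    by (meson always_eventually less_le_trans)
next
  fix a :: real assume "0 < a"
  \<comment> \<open>Subadditivity handles only integer factors, so \<open>a\<close> is replaced by a
    smaller bound \<open>1 / m\<close>.\<close>
  then obtain m where m: "m > 0" "inverse (real m) < a"
    using reals_Archimedean by (metis zero_less_Suc)
  have "\<forall>\<^sub>F n in sequentially. f (c n) / f (real n) < inverse (real m)"
    using order_tendstoD(2)[OF lim] m(1) by simp
  then show "\<forall>\<^sub>F n in sequentially. c n / real n < a"
    \<comment> \<open>Discards \<open>n = 0\<close>, where both denominators \<open>real n\<close>
      and \<open>f (real n)\<close> vanish.\<close>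
    using eventually_gt_at_top[of 0]
  proof eventually_elim
    case (elim n)
    have "0 < f (real n)"
      using modulus_function_pos[OF f] elim by simp
    then have "real m * f (c n) < f (real n)"
      using elim m(1) by (simp add: field_simps)
    then have "f (real m * c n) < f (real n)"
      using modulus_function_mult_of_nat_le[OF f c, of m n] by linarith
    \<comment> \<open>Contrapositive of monotonicity: a strict inequality between values passes to
      the arguments even if \<open>f\<close> is constant on some intervals.\<close>
    then have "real m * c n < real n"
      using modulus_function_mono[OF f, of "real n" "real m * c n"] by fastforce
    then have "c n / real n < inverse (real m)"
      using elim m(1) by (simp add: field_simps)
    then show ?case using m(2) by linarith
  qed
qed

lemma modulus_ratio_tendsto_0_if_ratio_tendsto_0:
  fixes c :: "nat \<Rightarrow> real"
  assumes f: "modulus_function f" and compat: "compatible_modulus f" and c: "\<And>n. 0 \<le> c n"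
    and lim: "(\<lambda>n. c n / real n) \<longlonglongrightarrow> 0"
  shows "(\<lambda>n. f (c n) / f (real n)) \<longlonglongrightarrow> 0"
proof (rule order_tendstoI)
  fix a :: real assume "a < 0"
  moreover have "0 \<le> f (c n) / f (real n)" for n
    using modulus_function_nonneg[OF f] c by simp
  ultimately show "\<forall>\<^sub>F n in sequentially. a < f (c n) / f (real n)"
    by (meson always_eventually less_le_trans)
next
  fix a :: real assume "0 < a"
  then have "\<forall>\<^sub>F e in at_right 0. modulus_limsup f e < ereal a"
    using compat order_tendstoD(2) unfolding compatible_modulus_def by fastforce
  \<comment> \<open>One positive \<open>e\<close> is fixed before \<open>n\<close> varies: the
    limsup bound at \<open>e\<close> controls \<open>f (n * e) / f n\<close>, and
    \<open>0 < e\<close> makes \<open>c n / n < e\<close> eventually true.\<close>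
  then have "\<forall>\<^sub>F e in at_right 0. modulus_limsup f e < ereal a \<and> 0 < e"
    using eventually_at_right_less by (rule eventually_conj)
  then obtain e where e: "modulus_limsup f e < ereal a" "0 < e"
    using eventually_happens'[OF trivial_limit_at_right_real] by blast
  have "\<forall>\<^sub>F n in sequentially. ereal (f (real n * e) / f (real n)) < ereal a"
    using e(1) unfolding modulus_limsup_def by (rule Limsup_lessD)
  moreover have "\<forall>\<^sub>F n in sequentially. c n / real n < e"
    using order_tendstoD(2)[OF lim e(2)] .
  ultimately show "\<forall>\<^sub>F n in sequentially. f (c n) / f (real n) < a"
    using eventually_gt_at_top[of 0]
  proof eventually_elim
    case (elim n)
    have "0 < f (real n)"
      using modulus_function_pos[OF f] elim by simp
    moreover have "f (c n) \<le> f (real n * e)"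
      using elim by (intro modulus_function_mono[OF f c]) (simp add: field_simps)
    ultimately have "f (c n) / f (real n) \<le> f (real n * e) / f (real n)"
      by (simp add: divide_right_mono)
    then show ?case using elim by simp
  qed
qed

text \<open>The equivalence holds separately for each \<epsilon>, with \<open>c n\<close> the number
  of exceptional indices up to \<open>n\<close>.\<close>

lemma f_statistically_convergent_iff_statistically_convergent:
  assumes "modulus_function f" "compatible_modulus f"
  shows "f_statistically_convergent f x L \<longleftrightarrow> statistically_convergent x L"
  unfolding f_statistically_convergent_def statistically_convergent_def
  using ratio_tendsto_0_if_modulus_ratio_tendsto_0[OF assms(1)]
    modulus_ratio_tendsto_0_if_ratio_tendsto_0[OF assms]
  by (meson of_nat_0_le_iff)

theorem theorem2p3:
  fixes f :: "real \<Rightarrow> real"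
    and A_seq :: "nat \<Rightarrow> 'a::metric_space set"
    and A :: "'a set"
  assumes "unbounded_modulus_function f"
    and "compatible_modulus f"
    and "\<And>k. k \<ge> 1 \<Longrightarrow> A_seq k \<in> CL"
    and "A \<in> CL"
  shows "Wijsman_f_statistically_convergent f A_seq A \<longleftrightarrow>
         Wijsman_statistically_convergent A_seq A"
  \<comment> \<open>Both Wijsman notions quantify over points, so the scalar equivalence is applied
    to the distance sequence at each point.\<close>
  using assms(1,2)
  unfolding Wijsman_f_statistically_convergent_def Wijsman_statistically_convergent_def
    unbounded_modulus_function_def
  by (simp add: f_statistically_convergent_iff_statistically_convergent)

end
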